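(* Let $K$ be a field of characteristic $\neq 2$ and let $\mathcal C$ be a 3-dimensional EACP over $K$ (natural basis $\{h_1,h_2,r\}$) with $\dim\mathcal C^2=1$. Then $\mathcal C$ is isomorphic to one of the following pairwise non-isomorphic algebras with basis $\{h_1,h_2,r\}$, in each of which $rh_i=h_ir$ ($i=1,2$) and all products not listed are zero: $\mathcal C_1$: $h_1r=r$; $\mathcal C_2$: $h_1r=h_2$; $\mathcal C_3$: $h_1r=h_1+r$.
   Context: An EACP over a field $K$ (characteristic $\neq 2$) is a $K$-algebra $\mathcal C$ with a basis $\{h_1,\dots,h_n,r\}$ (called a natural basis) whose multiplication is determined by bilinearity from $$h_ir=rh_i=\tfrac12\Big(\sum_{j=1}^n a_{ij}h_j+b_ir\Big),\qquad h_ih_j=0\ (i,j=1,\dots,n),\qquad rr=0,$$ for some constants $a_{ij},b_i\in K$. $\mathcal C^2$ denotes the span of all products $xy$, $x,y\in\mathcal C$. Isomorphism means algebra isomorphism. *)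

theory Defs
  imports "HOL-Analysis.Analysis"
begin

text \<open>Index type for the natural basis {h1, h2, r} of a 3-dimensional EACP.\<close>
datatype nb = H1 | H2 | R

lemma nb_UNIV: "(UNIV :: nb set) = {H1, H2, R}"
  using nb.exhaust by auto

instance nb :: finite
  by standard (simp add: nb_UNIV)

text \<open>A 3-dimensional algebra over a field 'k is given on 'k^nb by its structure
  constants: sc i j is the product of the i-th and j-th basis vectors.\<close>
definition alg_mult :: "(nb \<Rightarrow> nb \<Rightarrow> 'k::field ^ nb) \<Rightarrow> 'k ^ nb \<Rightarrow> 'k ^ nb \<Rightarrow> 'k ^ nb" where
  "alg_mult sc x y = (\<Sum>i\<in>UNIV. \<Sum>j\<in>UNIV. (x $ i * y $ j) *s sc i j)"

text \<open>The square C^2: span of all products (its dimension is the dimension of the span).\<close>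
definition alg_square :: "(nb \<Rightarrow> nb \<Rightarrow> 'k::field ^ nb) \<Rightarrow> ('k ^ nb) set" where
  "alg_square sc = vec.span {alg_mult sc x y | x y. True}"

text \<open>Algebra isomorphism: a linear bijection preserving the products.\<close>
definition alg_iso :: "(nb \<Rightarrow> nb \<Rightarrow> 'k::field ^ nb) \<Rightarrow> (nb \<Rightarrow> nb \<Rightarrow> 'k ^ nb) \<Rightarrow> bool" where
  "alg_iso sc1 sc2 \<longleftrightarrow> (\<exists>f :: 'k ^ nb \<Rightarrow> 'k ^ nb.
      Vector_Spaces.linear (*s) (*s) f \<and> bij f \<and>
      (\<forall>x y. f (alg_mult sc1 x y) = alg_mult sc2 (f x) (f y)))"

text \<open>Structure constants with h1 r = r h1 = u, h2 r = r h2 = v, all other basis products zero.\<close>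
definition sym_sc :: "'k::field ^ nb \<Rightarrow> 'k ^ nb \<Rightarrow> nb \<Rightarrow> nb \<Rightarrow> 'k ^ nb" where
  "sym_sc u v i j =
     (if (i = H1 \<and> j = R) \<or> (i = R \<and> j = H1) then u
      else if (i = H2 \<and> j = R) \<or> (i = R \<and> j = H2) then v
      else 0)"

text \<open>Coordinate vector c1 h1 + c2 h2 + c3 r.\<close>
definition coords :: "'k \<Rightarrow> 'k \<Rightarrow> 'k \<Rightarrow> 'k ^ nb" where
  "coords c1 c2 c3 = (\<chi> k. case k of H1 \<Rightarrow> c1 | H2 \<Rightarrow> c2 | R \<Rightarrow> c3)"

text \<open>The 3-dimensional EACP with natural basis {h1,h2,r}:
  h_i r = r h_i = 1/2 (a_i1 h1 + a_i2 h2 + b_i r), h_i h_j = 0, r r = 0.\<close>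
definition eacp3 :: "'k::field \<Rightarrow> 'k \<Rightarrow> 'k \<Rightarrow> 'k \<Rightarrow> 'k \<Rightarrow> 'k \<Rightarrow> nb \<Rightarrow> nb \<Rightarrow> 'k ^ nb" where
  "eacp3 a11 a12 a21 a22 b1 b2 =
     sym_sc ((1/2) *s coords a11 a12 b1) ((1/2) *s coords a21 a22 b2)"

definition C1 :: "nb \<Rightarrow> nb \<Rightarrow> 'k::field ^ nb" where
  "C1 = sym_sc (coords 0 0 1) 0"   \<comment> \<open>h1 r = r\<close>

definition C2 :: "nb \<Rightarrow> nb \<Rightarrow> 'k::field ^ nb" where
  "C2 = sym_sc (coords 0 1 0) 0"   \<comment> \<open>h1 r = h2\<close>

definition C3 :: "nb \<Rightarrow> nb \<Rightarrow> 'k::field ^ nb" where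
  "C3 = sym_sc (coords 1 0 1) 0"   \<comment> \<open>h1 r = h1 + r\<close>

end

theory Submission imports Defs begin

(* In the algebra sym_sc u v the square is spanned by u = h1 r and v = h2 r. If it is
   one-dimensional, a change of h1, h2 makes h2 r = 0 and h1 r = w with w nonzero; rescaling
   and shearing then bring w to r, h2 or h1 + r according to which of its h1- and
   r-coordinates vanish. The three normal forms are told apart by the identities C^2 C = 0,
   which holds only in C2, and C^2 C^2 = 0, which fails only in C3, where
   (h1 r)(h1 r) = (h1 + r)(h1 + r) = 2 h1 r is nonzero because the characteristic is not 2. *)

lemma coords_nth [simp]:
  "coords a b c $ H1 = a" "coords a b c $ H2 = b" "coords a b c $ R = c"
  by (simp_all add: coords_def)

lemma vec_nb_eq_iff: "(x::'k^nb) = y \<longleftrightarrow> x$H1 = y$H1 \<and> x$H2 = y$H2 \<and> x$R = y$R"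
  by (metis (full_types) nb.exhaust vec_eq_iff)

lemma coords_components: "coords (w$H1) (w$H2) (w$R) = w"
  by (simp add: vec_nb_eq_iff)

lemma alg_mult_sym_sc:
  "alg_mult (sym_sc u v) x y = (x$H1*y$R + x$R*y$H1) *s u + (x$H2*y$R + x$R*y$H2) *s v"
  unfolding alg_mult_def nb_UNIV by (simp add: sym_sc_def vec_eq_iff)

lemma alg_mult_sym_sc_nth:
  "alg_mult (sym_sc u v) x y $ k = (x$H1*y$R + x$R*y$H1) * u$k + (x$H2*y$R + x$R*y$H2) * v$k"
  by (simp add: alg_mult_sym_sc algebra_simps)

lemma alg_square_sym_sc: "alg_square (sym_sc u v) = vec.span {u, v}"
proof -
  let ?P = "{alg_mult (sym_sc u v) x y | x y. True}"
  have "?P \<subseteq> vec.span {u, v}"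
  proof
    fix p
    assume "p \<in> ?P"
    then obtain x y where p: "p = alg_mult (sym_sc u v) x y"
      by blast
    show "p \<in> vec.span {u, v}"
      unfolding p alg_mult_sym_sc by (intro vec.span_add vec.span_scale vec.span_base) auto
  qed
  then have "vec.span ?P \<subseteq> vec.span {u, v}"
    by (simp add: vec.span_minimal vec.subspace_span)
  moreover have "u = alg_mult (sym_sc u v) (coords 1 0 0) (coords 0 0 1)"
    and "v = alg_mult (sym_sc u v) (coords 0 1 0) (coords 0 0 1)"
    by (simp_all add: alg_mult_sym_sc)
  then have "vec.span {u, v} \<subseteq> vec.span ?P"
    by (intro vec.span_mono) blast
  ultimately show ?thesis
    unfolding alg_square_def by blast
qed

lemma dim_span_pair_eq_1_cases:
  fixes u v :: "'a::field ^ 'n::finite"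
  assumes "vec.dim (vec.span {u, v}) = 1"
  obtains b where "u \<noteq> 0" "v = b *s u" | "u = 0" "v \<noteq> 0"
proof (cases "u = 0")
  case True
  moreover have "v \<noteq> 0"
    using assms True vec.dim_span[of "{}"] by auto
  ultimately show ?thesis
    using that by blast
next
  case False
  have "v \<in> vec.span {u}"
  proof (rule ccontr)
    assume "v \<notin> vec.span {u}"
    then have "vec.independent {v, u}" and "v \<noteq> u"
      using False vec.span_base by (auto simp: vec.independent_insert)
    then have "vec.dim (vec.span {u, v}) = 2"
      by (simp add: vec.dim_eq_card_independent insert_commute)
    with assms show False
      by simp
  qed
  with False that show ?thesis
    by (auto simp: vec.span_singleton)
qed

lemma alg_isoI:
  fixes f g :: "'k::field ^ nb \<Rightarrow> 'k ^ nb"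
  assumes "\<And>x. g (f x) = x" "\<And>y. f (g y) = y"
    and "\<And>x y. f (x + y) = f x + f y" "\<And>c x. f (c *s x) = c *s f x"
    and "\<And>x y. f (alg_mult A x y) = alg_mult B (f x) (f y)"
  shows "alg_iso A B"
  unfolding alg_iso_def
proof (intro exI conjI)
  show "Vector_Spaces.linear (*s) (*s) f"
    unfolding Vector_Spaces.linear_iff using assms(3,4) vec.vector_space_axioms by auto
  show "bij f"
    using assms(1,2) by (metis bij_betw_byWitness UNIV_I subsetI)
qed (use assms in auto)

lemma alg_iso_trans:
  fixes A B C :: "nb \<Rightarrow> nb \<Rightarrow> 'k::field ^ nb"
  shows "alg_iso A B \<Longrightarrow> alg_iso B C \<Longrightarrow> alg_iso A C"
  unfolding alg_iso_def
proof (elim exE conjE)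
  fix f g :: "'k ^ nb \<Rightarrow> 'k ^ nb"
  assume "Vector_Spaces.linear (*s) (*s) f" "bij f" "\<forall>x y. f (alg_mult A x y) = alg_mult B (f x) (f y)"
    and "Vector_Spaces.linear (*s) (*s) g" "bij g" "\<forall>x y. g (alg_mult B x y) = alg_mult C (g x) (g y)"
  then show "\<exists>h. Vector_Spaces.linear (*s) (*s) h \<and> bij h \<and>
      (\<forall>x y. h (alg_mult A x y) = alg_mult C (h x) (h y))"
    by (intro exI[of _ "g \<circ> f"]) (simp add: Vector_Spaces.linear_compose bij_comp)
qed

lemma alg_iso_sym:
  fixes A B :: "nb \<Rightarrow> nb \<Rightarrow> 'k::field ^ nb"
  shows "alg_iso A B \<Longrightarrow> alg_iso B A"
  unfolding alg_iso_def
proof (elim exE conjE, intro exI conjI allI)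
  fix f :: "'k ^ nb \<Rightarrow> 'k ^ nb" and x y
  assume lin: "Vector_Spaces.linear (*s) (*s) f" and "bij f"
    and hom: "\<forall>x y. f (alg_mult A x y) = alg_mult B (f x) (f y)"
  then show "Vector_Spaces.linear (*s) (*s) (inv f)" and "bij (inv f)"
    by (simp_all add: vec.inj_linear_imp_inv_linear bij_is_inj bij_imp_bij_inv)
  have "f (alg_mult A (inv f x) (inv f y)) = alg_mult B x y"
    using hom \<open>bij f\<close> by (simp add: bij_is_surj surj_f_inv_f)
  then show "inv f (alg_mult B x y) = alg_mult A (inv f x) (inv f y)"
    using \<open>bij f\<close> by (metis bij_inv_eq_iff)
qed

definition square_mult_zero :: "(nb \<Rightarrow> nb \<Rightarrow> 'k::field ^ nb) \<Rightarrow> bool" where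
  "square_mult_zero A \<longleftrightarrow> (\<forall>x y z. alg_mult A (alg_mult A x y) z = 0)"

definition square_square_zero :: "(nb \<Rightarrow> nb \<Rightarrow> 'k::field ^ nb) \<Rightarrow> bool" where
  "square_square_zero A \<longleftrightarrow> (\<forall>x y z w. alg_mult A (alg_mult A x y) (alg_mult A z w) = 0)"

lemma alg_iso_surjective_hom:
  assumes "alg_iso A B"
  obtains f where "\<And>y. \<exists>x. y = f x" "f 0 = 0"
    and "\<And>x y. f (alg_mult A x y) = alg_mult B (f x) (f y)"
proof -
  obtain f where lin: "Vector_Spaces.linear (*s) (*s) f" and "bij f"
    and "\<And>x y. f (alg_mult A x y) = alg_mult B (f x) (f y)"
    using assms unfolding alg_iso_def by blast
  moreover have "f 0 = 0"
    using lin by (rule vec.linear_0)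
  ultimately show ?thesis
    using that by (metis bij_def surjD)
qed

lemma alg_iso_square_mult_zero:
  assumes "alg_iso A B" "square_mult_zero A"
  shows "square_mult_zero B"
proof -
  obtain f where "\<And>y. \<exists>x. y = f x" "f 0 = 0"
    and "\<And>x y. f (alg_mult A x y) = alg_mult B (f x) (f y)"
    using alg_iso_surjective_hom[OF assms(1)] by blast
  with assms(2) show ?thesis
    unfolding square_mult_zero_def by metis
qed

lemma alg_iso_square_square_zero:
  assumes "alg_iso A B" "square_square_zero A"
  shows "square_square_zero B"
proof -
  obtain f where "\<And>y. \<exists>x. y = f x" "f 0 = 0"
    and "\<And>x y. f (alg_mult A x y) = alg_mult B (f x) (f y)"
    using alg_iso_surjective_hom[OF assms(1)] by blast
  with assms(2) show ?thesis
    unfolding square_square_zero_def by metis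
qed

lemma not_square_mult_zero_C1: "\<not> square_mult_zero (C1 :: nb \<Rightarrow> nb \<Rightarrow> 'k::field ^ nb)"
proof -
  have "alg_mult C1 (alg_mult C1 (coords 1 0 0) (coords 0 0 1)) (coords 1 0 0) $ R = (1::'k)"
    by (simp add: C1_def alg_mult_sym_sc_nth)
  then show ?thesis
    unfolding square_mult_zero_def by force
qed

lemma square_mult_zero_C2: "square_mult_zero C2"
  by (simp add: square_mult_zero_def C2_def vec_nb_eq_iff alg_mult_sym_sc_nth)

lemma square_square_zero_C1: "square_square_zero C1"
  by (simp add: square_square_zero_def C1_def vec_nb_eq_iff alg_mult_sym_sc_nth)

lemma square_square_zero_C2: "square_square_zero C2"
  by (simp add: square_square_zero_def C2_def vec_nb_eq_iff alg_mult_sym_sc_nth)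

lemma not_square_square_zero_C3:
  assumes "(2::'k::field) \<noteq> 0"
  shows "\<not> square_square_zero (C3 :: nb \<Rightarrow> nb \<Rightarrow> 'k ^ nb)"
proof -
  let ?p = "alg_mult C3 (coords 1 0 0) (coords 0 0 1) :: 'k ^ nb"
  have "alg_mult C3 ?p ?p $ R = 2"
    by (simp add: C3_def alg_mult_sym_sc_nth)
  with assms show ?thesis
    unfolding square_square_zero_def by force
qed

lemma alg_iso_sym_sc_proportional:
  "alg_iso (sym_sc u (b *s u)) (sym_sc (coords (u$H1 + b * u$H2) (u$H2) (u$R)) 0)"
  by (rule alg_isoI[where f = "\<lambda>x. coords (x$H1 + b * x$H2) (x$H2) (x$R)"
                       and g = "\<lambda>y. coords (y$H1 - b * y$H2) (y$H2) (y$R)"])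
     (simp_all add: vec_nb_eq_iff alg_mult_sym_sc_nth algebra_simps)

lemma alg_iso_sym_sc_swap: "alg_iso (sym_sc 0 v) (sym_sc (coords (v$H2) (v$H1) (v$R)) 0)"
  by (rule alg_isoI[where f = "\<lambda>x. coords (x$H2) (x$H1) (x$R)"
                       and g = "\<lambda>y. coords (y$H2) (y$H1) (y$R)"])
     (simp_all add: vec_nb_eq_iff alg_mult_sym_sc_nth algebra_simps)

lemma alg_iso_sym_sc_rank_one:
  assumes "vec.dim (alg_square (sym_sc u v)) = 1"
  obtains w where "w \<noteq> 0" "alg_iso (sym_sc u v) (sym_sc w 0)"
  using assms unfolding alg_square_sym_sc
proof (cases rule: dim_span_pair_eq_1_cases)
  case (1 b)
  moreover have "coords (u$H1 + b * u$H2) (u$H2) (u$R) \<noteq> 0"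
    using 1 by (auto simp: vec_nb_eq_iff)
  ultimately show ?thesis
    using that alg_iso_sym_sc_proportional[of u b] by blast
next
  case 2
  moreover have "coords (v$H2) (v$H1) (v$R) \<noteq> 0"
    using 2 by (auto simp: vec_nb_eq_iff)
  ultimately show ?thesis
    using that alg_iso_sym_sc_swap[of v] by blast
qed

lemma alg_iso_C2_of_H2:
  assumes "c \<noteq> 0"
  shows "alg_iso (sym_sc (coords 0 c 0) 0) C2"
  unfolding C2_def
  by (rule alg_isoI[where f = "\<lambda>x. coords (x$H1) (x$H2 / c) (x$R)"
                       and g = "\<lambda>y. coords (y$H1) (c * y$H2) (y$R)"])
     (use assms in \<open>simp_all add: vec_nb_eq_iff alg_mult_sym_sc_nth field_simps\<close>)

lemma alg_iso_C1_of_R: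
  assumes "c3 \<noteq> 0"
  shows "alg_iso (sym_sc (coords 0 c2 c3) 0) C1"
  unfolding C1_def
  by (rule alg_isoI[where f = "\<lambda>x. coords (c3 * x$H1) (x$H2 - c2/c3 * x$R) (x$R)"
                       and g = "\<lambda>y. coords (y$H1 / c3) (y$H2 + c2/c3 * y$R) (y$R)"])
     (use assms in \<open>simp_all add: vec_nb_eq_iff alg_mult_sym_sc_nth field_simps\<close>)

lemma alg_iso_C1_of_H1:
  assumes "c1 \<noteq> 0"
  shows "alg_iso (sym_sc (coords c1 c2 0) 0) C1"
  unfolding C1_def
  by (rule alg_isoI[where f = "\<lambda>x. coords (c1 * x$R) (x$H2 - c2/c1 * x$H1) (x$H1)"
                       and g = "\<lambda>y. coords (y$R) (y$H2 + c2/c1 * y$R) (y$H1 / c1)"])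
     (use assms in \<open>simp_all add: vec_nb_eq_iff alg_mult_sym_sc_nth field_simps\<close>)

lemma alg_iso_C3:
  assumes "c1 \<noteq> 0" "c3 \<noteq> 0"
  shows "alg_iso (sym_sc (coords c1 c2 c3) 0) C3"
  unfolding C3_def
  by (rule alg_isoI[where f = "\<lambda>x. coords (c3 * x$H1) (x$H2 - c2/c3 * x$R) (c1 * x$R)"
                       and g = "\<lambda>y. coords (y$H1 / c3) (y$H2 + c2/(c1*c3) * y$R) (y$R / c1)"])
     (use assms in \<open>simp_all add: vec_nb_eq_iff alg_mult_sym_sc_nth field_simps\<close>)

lemma sym_sc_normal_forms:
  fixes w :: "'k::field ^ nb"
  assumes "w \<noteq> 0"
  shows "alg_iso (sym_sc w 0) C1 \<or> alg_iso (sym_sc w 0) C2 \<or> alg_iso (sym_sc w 0) C3"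
proof -
  have w: "sym_sc w 0 = sym_sc (coords (w$H1) (w$H2) (w$R)) 0"
    by (simp add: coords_components)
  consider "w$H1 = 0" "w$R = 0" | "w$H1 = 0" "w$R \<noteq> 0" | "w$H1 \<noteq> 0" "w$R = 0"
    | "w$H1 \<noteq> 0" "w$R \<noteq> 0"
    by blast
  then show ?thesis
  proof cases
    case 1
    with assms have "w$H2 \<noteq> 0"
      by (auto simp: vec_nb_eq_iff)
    with 1 show ?thesis
      using alg_iso_C2_of_H2 unfolding w by metis
  qed (use alg_iso_C1_of_R alg_iso_C1_of_H1 alg_iso_C3 w in metis)+
qed

theorem mainTheorem14:
  fixes a11 a12 a21 a22 b1 b2 :: "'k::field"
  assumes char: "(2::'k) \<noteq> 0"
    and sq: "vec.dim (alg_square (eacp3 a11 a12 a21 a22 b1 b2)) = 1"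
  shows "(alg_iso (eacp3 a11 a12 a21 a22 b1 b2) (C1 :: nb \<Rightarrow> nb \<Rightarrow> 'k ^ nb)
          \<or> alg_iso (eacp3 a11 a12 a21 a22 b1 b2) (C2 :: nb \<Rightarrow> nb \<Rightarrow> 'k ^ nb)
          \<or> alg_iso (eacp3 a11 a12 a21 a22 b1 b2) (C3 :: nb \<Rightarrow> nb \<Rightarrow> 'k ^ nb))
         \<and> \<not> alg_iso (C1 :: nb \<Rightarrow> nb \<Rightarrow> 'k ^ nb) C2
         \<and> \<not> alg_iso (C1 :: nb \<Rightarrow> nb \<Rightarrow> 'k ^ nb) C3
         \<and> \<not> alg_iso (C2 :: nb \<Rightarrow> nb \<Rightarrow> 'k ^ nb) C3"
proof (intro conjI)
  obtain w where "w \<noteq> 0" and iso_w: "alg_iso (eacp3 a11 a12 a21 a22 b1 b2) (sym_sc w 0)"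
    using sq unfolding eacp3_def by (rule alg_iso_sym_sc_rank_one) (simp add: eacp3_def)
  then show "alg_iso (eacp3 a11 a12 a21 a22 b1 b2) (C1 :: nb \<Rightarrow> nb \<Rightarrow> 'k ^ nb)
          \<or> alg_iso (eacp3 a11 a12 a21 a22 b1 b2) (C2 :: nb \<Rightarrow> nb \<Rightarrow> 'k ^ nb)
          \<or> alg_iso (eacp3 a11 a12 a21 a22 b1 b2) (C3 :: nb \<Rightarrow> nb \<Rightarrow> 'k ^ nb)"
    using sym_sc_normal_forms alg_iso_trans by blast
  show "\<not> alg_iso (C1 :: nb \<Rightarrow> nb \<Rightarrow> 'k ^ nb) C2"
    using alg_iso_sym alg_iso_square_mult_zero square_mult_zero_C2 not_square_mult_zero_C1
    by blast
  show "\<not> alg_iso (C1 :: nb \<Rightarrow> nb \<Rightarrow> 'k ^ nb) C3"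
    using alg_iso_square_square_zero square_square_zero_C1 not_square_square_zero_C3[OF char]
    by blast
  show "\<not> alg_iso (C2 :: nb \<Rightarrow> nb \<Rightarrow> 'k ^ nb) C3"
    using alg_iso_square_square_zero square_square_zero_C2 not_square_square_zero_C3[OF char]
    by blast
qed

end
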